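(* Let $P$ be a GPEA, $\gamma$ a unitizing automorphism of $P$, and $U$ the $\gamma$-unitization of $P$. If $I$ is a normal Riesz ideal in $U$, then its restriction $I\cap P$ to $P$ is a $\gamma$-closed normal Riesz ideal in $P$.
   Context: A GPEA is $(P;\oplus,0)$ with partial $\oplus$ satisfying partial associativity, conjugation ($a\oplus b=c\oplus a=b\oplus d$ for some $c,d$), two-sided cancellation, neutral $0$, positivity. Order $a\le b$ iff $a\oplus c=b$ for some $c$; for $a\le b$, $a/b$ is the unique $c$ with $a\oplus c=b$ and $b\backslash a$ the unique $d$ with $d\oplus a=b$. A unitizing automorphism $\gamma$ is a GPEA-automorphism with $\gamma a\oplus b$ defined iff $b\oplus a$ defined. The $\gamma$-unitization $U=P\cup P^\eta$ ($\eta\colon P\to P^\eta$ bijection onto a disjoint set, $1:=\eta0$): sums in $P$ as in $P$; $a+\eta b$ defined iff $a\le b$, equal to $\eta(b\backslash a)$; $\eta a+b$ defined iff $\gamma b\le a$, equal to $\eta(\gamma b/a)$; no sums within $P^\eta$. $U$ is a pseudo effect algebra with $\eta a=a^\sim$, $\gamma a=a^{--}$. Ideal: nonempty down-set closed under existing sums; normal: $a\oplus c=c\oplus b$ implies ($a\in I\Leftrightarrow b\in I$). Riesz ideal: satisfies (R1) if $i\in I$, $i\le a\oplus b$, then $i\le j\oplus k$ for some $j,k\in I$, $j\le a$, $k\le b$; and (R2) if $i\in I$, $i\le a$, then (i) if $(a\backslash i)\oplus b$ exists there is $j\in I$, $j\le b$, with $a\oplus(j/b)$ existing, (ii) if $b\oplus(i/a)$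 exists there is $k\in I$, $k\le b$, with $(b\backslash k)\oplus a$ existing. An ideal $J$ of $P$ is $\gamma$-closed iff $a\in J\Leftrightarrow\gamma a\in J$ for all $a\in P$. *)

theory Defs
  imports Main
begin

text \<open>
  Algebras with one partial binary operation.  The value \<^term>\<open>None\<close> means that the sum is
  undefined; values of the operation on arguments outside the carrier are irrelevant.
\<close>

record 'a partial_algebra =
  carrier :: "'a set"
  psum :: "'a \<Rightarrow> 'a \<Rightarrow> 'a option" (infixl "\<oplus>\<index>" 65)
  pzero :: 'a ("\<zero>\<index>")

record 'a partial_algebra_unit = "'a partial_algebra" +
  punit :: 'a ("\<one>\<index>")

text \<open>
  Associativity: one iterated sum exists iff the other does, and then they are equal.
\<close>

locale gpea =
  fixes P :: "('a, 'b) partial_algebra_scheme" (structure)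
  assumes sum_closed:
      "\<lbrakk>a \<in> carrier P; b \<in> carrier P; a \<oplus> b = Some c\<rbrakk> \<Longrightarrow> c \<in> carrier P"
    and zero_closed: "\<zero> \<in> carrier P"
    and assoc:
      "\<lbrakk>a \<in> carrier P; b \<in> carrier P; c \<in> carrier P\<rbrakk> \<Longrightarrow>
        (\<exists>s. a \<oplus> b = Some s \<and> s \<oplus> c = Some d) \<longleftrightarrow>
        (\<exists>t. b \<oplus> c = Some t \<and> a \<oplus> t = Some d)"
    and conjugation:
      "\<lbrakk>a \<in> carrier P; b \<in> carrier P; a \<oplus> b = Some s\<rbrakk> \<Longrightarrow>
        \<exists>c\<in>carrier P. \<exists>d\<in>carrier P. c \<oplus> a = Some s \<and> b \<oplus> d = Some s"
    and left_cancel: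
      "\<lbrakk>a \<in> carrier P; b \<in> carrier P; c \<in> carrier P; a \<oplus> b = Some s; a \<oplus> c = Some s\<rbrakk>
        \<Longrightarrow> b = c"
    and right_cancel:
      "\<lbrakk>a \<in> carrier P; b \<in> carrier P; c \<in> carrier P; b \<oplus> a = Some s; c \<oplus> a = Some s\<rbrakk>
        \<Longrightarrow> b = c"
    and neutral: "a \<in> carrier P \<Longrightarrow> a \<oplus> \<zero> = Some a \<and> \<zero> \<oplus> a = Some a"
    and positive:
      "\<lbrakk>a \<in> carrier P; b \<in> carrier P; a \<oplus> b = Some \<zero>\<rbrakk> \<Longrightarrow> a = \<zero> \<and> b = \<zero>"

definition ple :: "('a, 'b) partial_algebra_scheme \<Rightarrow> 'a \<Rightarrow> 'a \<Rightarrow> bool"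
    (infix "\<sqsubseteq>\<index>" 50) where
  "a \<sqsubseteq>\<^bsub>P\<^esub> b \<longleftrightarrow> (\<exists>c\<in>carrier P. a \<oplus>\<^bsub>P\<^esub> c = Some b)"

text \<open>
  For \<open>a \<le> b\<close> the two differences: \<open>ldiff P a b\<close> is \<open>a / b\<close> (so \<open>a \<oplus> (a / b) = b\<close>) and
  \<open>rdiff P b a\<close> is \<open>b \ a\<close> (so \<open>(b \ a) \<oplus> a = b\<close>).
\<close>

definition ldiff :: "('a, 'b) partial_algebra_scheme \<Rightarrow> 'a \<Rightarrow> 'a \<Rightarrow> 'a" where
  "ldiff P a b = (THE c. c \<in> carrier P \<and> a \<oplus>\<^bsub>P\<^esub> c = Some b)"

definition rdiff :: "('a, 'b) partial_algebra_scheme \<Rightarrow> 'a \<Rightarrow> 'a \<Rightarrow> 'a" where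
  "rdiff P b a = (THE d. d \<in> carrier P \<and> d \<oplus>\<^bsub>P\<^esub> a = Some b)"

text \<open>
  The equation with \<^term>\<open>map_option\<close> says that \<open>\<gamma> a \<oplus> \<gamma> b\<close> exists iff \<open>a \<oplus> b\<close> does, and
  then equals \<open>\<gamma> (a \<oplus> b)\<close>; thus \<open>\<gamma>\<close> and its inverse preserve sums.
\<close>

definition gpea_automorphism ::
    "('a, 'b) partial_algebra_scheme \<Rightarrow> ('a \<Rightarrow> 'a) \<Rightarrow> bool" where
  "gpea_automorphism P \<gamma> \<longleftrightarrow>
     bij_betw \<gamma> (carrier P) (carrier P) \<and>
     (\<forall>a\<in>carrier P. \<forall>b\<in>carrier P. \<gamma> a \<oplus>\<^bsub>P\<^esub> \<gamma> b = map_option \<gamma> (a \<oplus>\<^bsub>P\<^esub> b))"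

definition unitizing_automorphism ::
    "('a, 'b) partial_algebra_scheme \<Rightarrow> ('a \<Rightarrow> 'a) \<Rightarrow> bool" where
  "unitizing_automorphism P \<gamma> \<longleftrightarrow>
     gpea_automorphism P \<gamma> \<and>
     (\<forall>a\<in>carrier P. \<forall>b\<in>carrier P. \<gamma> a \<oplus>\<^bsub>P\<^esub> b \<noteq> None \<longleftrightarrow> b \<oplus>\<^bsub>P\<^esub> a \<noteq> None)"

text \<open>
  The map \<open>\<eta>\<close> is meant to be injective on the carrier of \<open>P\<close> with image disjoint from it; the
  arguments \<open>x\<close> and \<open>y\<close> below are then of exactly one of the forms \<open>a\<close> or \<open>\<eta> a\<close> with \<open>a\<close> in
  the carrier.
\<close>

definition unitization ::
    "('a, 'b) partial_algebra_scheme \<Rightarrow> ('a \<Rightarrow> 'a) \<Rightarrow> ('a \<Rightarrow> 'a) \<Rightarrow> 'a partial_algebra_unit" where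
  "unitization P \<gamma> \<eta> =
     \<lparr>carrier = carrier P \<union> \<eta> ` carrier P,
      psum = (\<lambda>x y.
        if x \<in> carrier P \<and> y \<in> carrier P then x \<oplus>\<^bsub>P\<^esub> y
        else if x \<in> carrier P \<and> y \<in> \<eta> ` carrier P then
          (let b = inv_into (carrier P) \<eta> y in
             if x \<sqsubseteq>\<^bsub>P\<^esub> b then Some (\<eta> (rdiff P b x)) else None)
        else if x \<in> \<eta> ` carrier P \<and> y \<in> carrier P then
          (let a = inv_into (carrier P) \<eta> x in
             if \<gamma> y \<sqsubseteq>\<^bsub>P\<^esub> a then Some (\<eta> (ldiff P (\<gamma> y) a)) else None)
        else None),
      pzero = \<zero>\<^bsub>P\<^esub>,
      punit = \<eta> \<zero>\<^bsub>P\<^esub>\<rparr>"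

definition pideal :: "('a, 'b) partial_algebra_scheme \<Rightarrow> 'a set \<Rightarrow> bool" where
  "pideal P I \<longleftrightarrow>
     I \<subseteq> carrier P \<and> I \<noteq> {} \<and>
     (\<forall>a\<in>carrier P. \<forall>i\<in>I. a \<sqsubseteq>\<^bsub>P\<^esub> i \<longrightarrow> a \<in> I) \<and>
     (\<forall>i\<in>I. \<forall>j\<in>I. \<forall>s. i \<oplus>\<^bsub>P\<^esub> j = Some s \<longrightarrow> s \<in> I)"

definition normal_pideal :: "('a, 'b) partial_algebra_scheme \<Rightarrow> 'a set \<Rightarrow> bool" where
  "normal_pideal P I \<longleftrightarrow>
     pideal P I \<and>
     (\<forall>a\<in>carrier P. \<forall>b\<in>carrier P. \<forall>c\<in>carrier P. \<forall>s.
        a \<oplus>\<^bsub>P\<^esub> c = Some s \<and> c \<oplus>\<^bsub>P\<^esub> b = Some s \<longrightarrow> (a \<in> I \<longleftrightarrow> b \<in> I))"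

definition riesz_R1 :: "('a, 'b) partial_algebra_scheme \<Rightarrow> 'a set \<Rightarrow> bool" where
  "riesz_R1 P I \<longleftrightarrow>
     (\<forall>i\<in>I. \<forall>a\<in>carrier P. \<forall>b\<in>carrier P. \<forall>s.
        a \<oplus>\<^bsub>P\<^esub> b = Some s \<and> i \<sqsubseteq>\<^bsub>P\<^esub> s \<longrightarrow>
        (\<exists>j\<in>I. \<exists>k\<in>I. j \<sqsubseteq>\<^bsub>P\<^esub> a \<and> k \<sqsubseteq>\<^bsub>P\<^esub> b \<and>
           (\<exists>t. j \<oplus>\<^bsub>P\<^esub> k = Some t \<and> i \<sqsubseteq>\<^bsub>P\<^esub> t)))"

definition riesz_R2 :: "('a, 'b) partial_algebra_scheme \<Rightarrow> 'a set \<Rightarrow> bool" where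
  "riesz_R2 P I \<longleftrightarrow>
     (\<forall>i\<in>I. \<forall>a\<in>carrier P. \<forall>b\<in>carrier P. i \<sqsubseteq>\<^bsub>P\<^esub> a \<longrightarrow>
        (rdiff P a i \<oplus>\<^bsub>P\<^esub> b \<noteq> None \<longrightarrow>
           (\<exists>j\<in>I. j \<sqsubseteq>\<^bsub>P\<^esub> b \<and> a \<oplus>\<^bsub>P\<^esub> ldiff P j b \<noteq> None)) \<and>
        (b \<oplus>\<^bsub>P\<^esub> ldiff P i a \<noteq> None \<longrightarrow>
           (\<exists>k\<in>I. k \<sqsubseteq>\<^bsub>P\<^esub> b \<and> rdiff P b k \<oplus>\<^bsub>P\<^esub> a \<noteq> None)))"

definition riesz_pideal :: "('a, 'b) partial_algebra_scheme \<Rightarrow> 'a set \<Rightarrow> bool" where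
  "riesz_pideal P I \<longleftrightarrow> pideal P I \<and> riesz_R1 P I \<and> riesz_R2 P I"

definition gamma_closed ::
    "('a, 'b) partial_algebra_scheme \<Rightarrow> ('a \<Rightarrow> 'a) \<Rightarrow> 'a set \<Rightarrow> bool" where
  "gamma_closed P \<gamma> J \<longleftrightarrow> (\<forall>a\<in>carrier P. a \<in> J \<longleftrightarrow> \<gamma> a \<in> J)"

end

theory Submission
  imports Defs
begin

text \<open>
  Every summand of an element of \<open>P\<close> in \<open>U\<close> lies in \<open>P\<close>, so order and differences of \<open>U\<close> restrict
  to those of \<open>P\<close>, and the ideal properties transfer.  For \<open>\<gamma>\<close>-closedness, the unit of \<open>U\<close> is both
  \<open>\<gamma> a \<oplus> \<eta> (\<gamma> a)\<close> and \<open>\<eta> (\<gamma> a) \<oplus> a\<close>, so normality of \<open>I\<close> gives \<open>\<gamma> a \<in> I \<longleftrightarrow> a \<in> I\<close>.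
\<close>

section \<open>Order and differences inside a GPEA\<close>

context gpea
begin

lemma ldiff_eq:
  assumes "a \<in> carrier P" "c \<in> carrier P" "a \<oplus> c = Some b"
  shows "ldiff P a b = c"
  unfolding ldiff_def using assms left_cancel by (intro the_equality) blast+

lemma rdiff_eq:
  assumes "a \<in> carrier P" "d \<in> carrier P" "d \<oplus> a = Some b"
  shows "rdiff P b a = d"
  unfolding rdiff_def using assms right_cancel by (intro the_equality) blast+

lemma ple_refl: "a \<in> carrier P \<Longrightarrow> a \<sqsubseteq> a"
  using neutral zero_closed by (auto simp: ple_def)

lemma ldiff_closed: "a \<in> carrier P \<Longrightarrow> a \<sqsubseteq> b \<Longrightarrow> ldiff P a b \<in> carrier P"
  unfolding ple_def using ldiff_eq by auto

text \<open>The order \<open>a \<sqsubseteq> b\<close> only provides a summand to the right of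
  \<open>a\<close>. Conjugation trades it for one on the left, which is the difference that
  \<open>rdiff\<close> describes.\<close>

lemma rdiff_closed: "a \<in> carrier P \<Longrightarrow> a \<sqsubseteq> b \<Longrightarrow> rdiff P b a \<in> carrier P"
  unfolding ple_def using rdiff_eq conjugation by metis

end

section \<open>Sums, order and differences in the unitization\<close>

locale gpea_unitization = gpea P for P :: "('a, 'b) partial_algebra_scheme" +
  fixes \<gamma> \<eta> :: "'a \<Rightarrow> 'a" and U :: "'a partial_algebra_unit"
  assumes gamma: "unitizing_automorphism P \<gamma>"
    and inj: "inj_on \<eta> (carrier P)"
    and disj: "\<eta> ` carrier P \<inter> carrier P = {}"
    and U: "U = unitization P \<gamma> \<eta>"
begin

lemma gamma_mem: "a \<in> carrier P \<Longrightarrow> \<gamma> a \<in> carrier P"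
  using gamma unfolding unitizing_automorphism_def gpea_automorphism_def
  by (blast dest: bij_betwE)

lemma eta_notin: "a \<in> carrier P \<Longrightarrow> \<eta> a \<notin> carrier P"
  using disj by blast

lemma carrier_U: "carrier U = carrier P \<union> \<eta> ` carrier P"
  by (simp add: U unitization_def)

lemma psum_base: "a \<in> carrier P \<Longrightarrow> b \<in> carrier P \<Longrightarrow> a \<oplus>\<^bsub>U\<^esub> b = a \<oplus>\<^bsub>P\<^esub> b"
  by (simp add: U unitization_def)

text \<open>Disjointness, through \<open>eta_notin\<close>, decides which branch of the case
  distinction in \<open>unitization\<close> applies; injectivity of \<eta> makes
  \<open>inv_into\<close> return \<open>b\<close> itself.\<close>

lemma psum_eta_right:
  "a \<in> carrier P \<Longrightarrow> b \<in> carrier P \<Longrightarrow>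
    a \<oplus>\<^bsub>U\<^esub> \<eta> b = (if a \<sqsubseteq>\<^bsub>P\<^esub> b then Some (\<eta> (rdiff P b a)) else None)"
  by (simp add: U unitization_def eta_notin inj)

lemma psum_eta_left:
  "a \<in> carrier P \<Longrightarrow> b \<in> carrier P \<Longrightarrow>
    \<eta> a \<oplus>\<^bsub>U\<^esub> b = (if \<gamma> b \<sqsubseteq>\<^bsub>P\<^esub> a then Some (\<eta> (ldiff P (\<gamma> b) a)) else None)"
  by (simp add: U unitization_def eta_notin inj)

lemma psum_eta_eta:
  "a \<in> carrier P \<Longrightarrow> b \<in> carrier P \<Longrightarrow> \<eta> a \<oplus>\<^bsub>U\<^esub> \<eta> b = None"
  by (simp add: U unitization_def eta_notin)

text \<open>A mixed sum has the form \<open>\<eta> d\<close> where \<open>d\<close> is a difference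
  formed in \<open>P\<close>; since \<open>d\<close> lies in \<open>P\<close>, the value
  \<open>\<eta> d\<close> lies outside it. Two summands from the image of \<eta> have no sum. Only
  sums of two elements of \<open>P\<close> are left.\<close>

lemma summands_in_base:
  assumes "x \<in> carrier U" "y \<in> carrier U" "x \<oplus>\<^bsub>U\<^esub> y = Some p" "p \<in> carrier P"
  shows "x \<in> carrier P" "y \<in> carrier P"
  using assms disj
  by (auto simp: carrier_U psum_eta_right psum_eta_left psum_eta_eta eta_notin
      rdiff_closed ldiff_closed gamma_mem split: if_splits)

lemma ple_base_iff:
  assumes "x \<in> carrier U" "p \<in> carrier P"
  shows "x \<sqsubseteq>\<^bsub>U\<^esub> p \<longleftrightarrow> x \<in> carrier P \<and> x \<sqsubseteq>\<^bsub>P\<^esub> p"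
  unfolding ple_def using assms summands_in_base[OF assms(1) _ _ assms(2)]
  by (metis carrier_U UnI1 psum_base)

text \<open>The two properties under the description operator are equivalent, because any complement
  found in \<open>U\<close> already lies in \<open>P\<close>. Hence the terms agree even when no
  difference exists, and no order hypothesis is required.\<close>

lemma ldiff_base:
  assumes "a \<in> carrier P" "b \<in> carrier P"
  shows "ldiff U a b = ldiff P a b"
proof -
  have "c \<in> carrier U \<and> a \<oplus>\<^bsub>U\<^esub> c = Some b \<longleftrightarrow> c \<in> carrier P \<and> a \<oplus>\<^bsub>P\<^esub> c = Some b" for c
    using assms summands_in_base by (metis carrier_U UnI1 psum_base)
  then show ?thesis by (simp add: ldiff_def)
qed

lemma rdiff_base:
  assumes "a \<in> carrier P" "b \<in> carrier P"
  shows "rdiff U b a = rdiff P b a"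
proof -
  have "c \<in> carrier U \<and> c \<oplus>\<^bsub>U\<^esub> a = Some b \<longleftrightarrow> c \<in> carrier P \<and> c \<oplus>\<^bsub>P\<^esub> a = Some b" for c
    using assms summands_in_base by (metis carrier_U UnI1 psum_base)
  then show ?thesis by (simp add: rdiff_def)
qed

text \<open>Serves to show that an ideal of \<open>U\<close> meets \<open>P\<close>, so it has to
  cover the elements of the form \<open>\<eta> a\<close> as well.\<close>

lemma zero_ple:
  assumes "x \<in> carrier U"
  shows "\<zero>\<^bsub>P\<^esub> \<sqsubseteq>\<^bsub>U\<^esub> x"
proof -
  have "\<zero>\<^bsub>P\<^esub> \<oplus>\<^bsub>U\<^esub> x = Some x"
    using assms unfolding carrier_U
  proof
    assume "x \<in> carrier P"
    then show ?thesis by (simp add: psum_base zero_closed neutral)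
  next
    assume "x \<in> \<eta> ` carrier P"
    then obtain a where a: "a \<in> carrier P" "x = \<eta> a" by blast
    have "\<zero>\<^bsub>P\<^esub> \<sqsubseteq>\<^bsub>P\<^esub> a" using a neutral by (auto simp: ple_def)
    \<comment> \<open>The sum of zero and \<open>\<eta> a\<close> is \<eta> of this difference,
      hence \<open>\<eta> a\<close> again.\<close>
    moreover have "rdiff P a \<zero>\<^bsub>P\<^esub> = a" using a neutral zero_closed by (simp add: rdiff_eq)
    ultimately show ?thesis using a by (simp add: psum_eta_right zero_closed)
  qed
  then show ?thesis using assms by (auto simp: ple_def)
qed

section \<open>Restriction of ideals and of normality\<close>

lemma pideal_restrict:
  assumes "pideal U I"
  shows "pideal P (I \<inter> carrier P)"
proof -
  have I: "I \<subseteq> carrier U" "I \<noteq> {}"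
      "\<And>a i. a \<in> carrier U \<Longrightarrow> i \<in> I \<Longrightarrow> a \<sqsubseteq>\<^bsub>U\<^esub> i \<Longrightarrow> a \<in> I"
      "\<And>i j s. i \<in> I \<Longrightarrow> j \<in> I \<Longrightarrow> i \<oplus>\<^bsub>U\<^esub> j = Some s \<Longrightarrow> s \<in> I"
    using assms unfolding pideal_def by blast+
  \<comment> \<open>A member of \<open>I\<close> may lie in the image of \<eta>; the zero below it
    is the element that makes the intersection nonempty.\<close>
  have "\<zero>\<^bsub>P\<^esub> \<in> I"
    using I(1,2) I(3)[OF _ _ zero_ple] zero_closed by (auto simp: carrier_U)
  moreover have "a \<in> I" if "a \<in> carrier P" "i \<in> I \<inter> carrier P" "a \<sqsubseteq>\<^bsub>P\<^esub> i" for a i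
    using that I(3)[of a i] by (auto simp: carrier_U ple_base_iff)
  moreover have "s \<in> I \<inter> carrier P"
    if "i \<in> I \<inter> carrier P" "j \<in> I \<inter> carrier P" "i \<oplus>\<^bsub>P\<^esub> j = Some s" for i j s
    using that I(4)[of i j s] sum_closed by (auto simp: psum_base)
  ultimately show ?thesis
    unfolding pideal_def using zero_closed by blast
qed

lemma normal_pideal_restrict:
  assumes "normal_pideal U I"
  shows "normal_pideal P (I \<inter> carrier P)"
proof -
  have "a \<in> I \<longleftrightarrow> b \<in> I"
    if "a \<in> carrier P" "b \<in> carrier P" "c \<in> carrier P"
      "a \<oplus>\<^bsub>P\<^esub> c = Some s" "c \<oplus>\<^bsub>P\<^esub> b = Some s" for a b c s
    using assms that unfolding normal_pideal_def by (metis carrier_U UnI1 psum_base)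
  then show ?thesis
    using assms pideal_restrict unfolding normal_pideal_def by blast
qed

section \<open>Restriction of the two Riesz conditions\<close>

lemma riesz_R1_restrict:
  assumes "riesz_R1 U I" "I \<subseteq> carrier U"
  shows "riesz_R1 P (I \<inter> carrier P)"
  unfolding riesz_R1_def
proof (intro ballI allI impI)
  fix i a b s
  assume i: "i \<in> I \<inter> carrier P" and ab: "a \<in> carrier P" "b \<in> carrier P"
    and s: "a \<oplus>\<^bsub>P\<^esub> b = Some s \<and> i \<sqsubseteq>\<^bsub>P\<^esub> s"
  have U: "i \<in> I" "i \<in> carrier U" "a \<in> carrier U" "b \<in> carrier U"
    using i ab by (auto simp: carrier_U)
  \<comment> \<open>The order transfers between \<open>P\<close> and \<open>U\<close> only below an
    element of \<open>P\<close>, so \<open>s\<close> is placed there first.\<close>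
  have "s \<in> carrier P" using ab s sum_closed by blast
  then have "a \<oplus>\<^bsub>U\<^esub> b = Some s \<and> i \<sqsubseteq>\<^bsub>U\<^esub> s"
    using i ab s U by (simp add: psum_base ple_base_iff)
  then obtain j k t where jk: "j \<in> I" "k \<in> I" "j \<sqsubseteq>\<^bsub>U\<^esub> a" "k \<sqsubseteq>\<^bsub>U\<^esub> b"
      and t: "j \<oplus>\<^bsub>U\<^esub> k = Some t" "i \<sqsubseteq>\<^bsub>U\<^esub> t"
    using assms(1) U unfolding riesz_R1_def by blast
  \<comment> \<open>The witnesses are supplied by \<open>U\<close>, but they lie below
    \<open>a\<close> and \<open>b\<close>, which pulls them into \<open>P\<close>.\<close>
  then have P: "j \<in> carrier P" "k \<in> carrier P" "j \<sqsubseteq>\<^bsub>P\<^esub> a" "k \<sqsubseteq>\<^bsub>P\<^esub> b"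
    using assms(2) ab ple_base_iff by blast+
  then have "j \<oplus>\<^bsub>P\<^esub> k = Some t" using t by (simp add: psum_base)
  moreover from this have "i \<sqsubseteq>\<^bsub>P\<^esub> t"
    using P t U sum_closed ple_base_iff by blast
  ultimately show "\<exists>j\<in>I \<inter> carrier P. \<exists>k\<in>I \<inter> carrier P. j \<sqsubseteq>\<^bsub>P\<^esub> a \<and> k \<sqsubseteq>\<^bsub>P\<^esub> b \<and>
      (\<exists>t. j \<oplus>\<^bsub>P\<^esub> k = Some t \<and> i \<sqsubseteq>\<^bsub>P\<^esub> t)"
    using jk P by blast
qed

lemma riesz_R2_restrict:
  assumes R2: "riesz_R2 U I" and sub: "I \<subseteq> carrier U"
  shows "riesz_R2 P (I \<inter> carrier P)"
  unfolding riesz_R2_def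
proof (intro ballI impI conjI)
  fix i a b
  assume i: "i \<in> I \<inter> carrier P" and ab: "a \<in> carrier P" "b \<in> carrier P"
    and le: "i \<sqsubseteq>\<^bsub>P\<^esub> a"
  have U: "i \<in> I" "a \<in> carrier U" "b \<in> carrier U" "i \<sqsubseteq>\<^bsub>U\<^esub> a"
    using i ab le by (auto simp: carrier_U ple_base_iff)
  {
    assume "rdiff P a i \<oplus>\<^bsub>P\<^esub> b \<noteq> None"
    \<comment> \<open>Since the difference lies in \<open>P\<close>, both it and its sum with
      \<open>b\<close> mean the same in \<open>U\<close>.\<close>
    then have "rdiff U a i \<oplus>\<^bsub>U\<^esub> b \<noteq> None"
      using i ab le by (simp add: rdiff_base psum_base rdiff_closed)
    then obtain j where j: "j \<in> I" "j \<sqsubseteq>\<^bsub>U\<^esub> b" "a \<oplus>\<^bsub>U\<^esub> ldiff U j b \<noteq> None"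
      using R2 U unfolding riesz_R2_def by blast
    then have "j \<in> carrier P" "j \<sqsubseteq>\<^bsub>P\<^esub> b" using sub ab ple_base_iff by blast+
    with j ab show "\<exists>j\<in>I \<inter> carrier P. j \<sqsubseteq>\<^bsub>P\<^esub> b \<and> a \<oplus>\<^bsub>P\<^esub> ldiff P j b \<noteq> None"
      by (auto simp: ldiff_base psum_base ldiff_closed intro!: bexI[of _ j])
  next
    \<comment> \<open>The mirror image of the first half, with left and right differences
      exchanged.\<close>
    assume "b \<oplus>\<^bsub>P\<^esub> ldiff P i a \<noteq> None"
    then have "b \<oplus>\<^bsub>U\<^esub> ldiff U i a \<noteq> None"
      using i ab le by (simp add: ldiff_base psum_base ldiff_closed)
    then obtain k where k: "k \<in> I" "k \<sqsubseteq>\<^bsub>U\<^esub> b" "rdiff U b k \<oplus>\<^bsub>U\<^esub> a \<noteq> None"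
      using R2 U unfolding riesz_R2_def by blast
    then have "k \<in> carrier P" "k \<sqsubseteq>\<^bsub>P\<^esub> b" using sub ab ple_base_iff by blast+
    with k ab show "\<exists>k\<in>I \<inter> carrier P. k \<sqsubseteq>\<^bsub>P\<^esub> b \<and> rdiff P b k \<oplus>\<^bsub>P\<^esub> a \<noteq> None"
      by (auto simp: rdiff_base psum_base rdiff_closed intro!: bexI[of _ k])
  }
qed

lemma riesz_pideal_restrict:
  assumes "riesz_pideal U I"
  shows "riesz_pideal P (I \<inter> carrier P)"
proof -
  have "I \<subseteq> carrier U" using assms by (simp add: riesz_pideal_def pideal_def)
  then show ?thesis
    using assms pideal_restrict riesz_R1_restrict riesz_R2_restrict
    unfolding riesz_pideal_def by blast
qed

section \<open>Closure under \<gamma>\<close>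

lemma gamma_closed_restrict:
  assumes "normal_pideal U I"
  shows "gamma_closed P \<gamma> (I \<inter> carrier P)"
  unfolding gamma_closed_def
proof
  fix a assume a: "a \<in> carrier P"
  let ?g = "\<gamma> a"
  have g: "?g \<in> carrier P" "?g \<sqsubseteq>\<^bsub>P\<^esub> ?g" using a gamma_mem ple_refl by auto
  have "rdiff P ?g ?g = \<zero>\<^bsub>P\<^esub>" "ldiff P ?g ?g = \<zero>\<^bsub>P\<^esub>"
    using g neutral zero_closed by (simp_all add: rdiff_eq ldiff_eq)
  \<comment> \<open>A left summand \<eta> twists its right summand by \<gamma>: the second sum
    compares \<open>?g\<close> with \<open>\<gamma> a\<close>, which is \<open>?g\<close> itself.
    Both sums therefore reduce to a difference of \<open>?g\<close> with itself.\<close>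
  then have "?g \<oplus>\<^bsub>U\<^esub> \<eta> ?g = Some (\<eta> \<zero>\<^bsub>P\<^esub>)" "\<eta> ?g \<oplus>\<^bsub>U\<^esub> a = Some (\<eta> \<zero>\<^bsub>P\<^esub>)"
    using a g by (simp_all add: psum_eta_right psum_eta_left)
  moreover have "?g \<in> carrier U" "a \<in> carrier U" "\<eta> ?g \<in> carrier U"
    using a g by (auto simp: carrier_U)
  \<comment> \<open>Normality in \<open>U\<close> with the common summand \<open>\<eta> ?g\<close>,
    an element outside \<open>P\<close>.\<close>
  ultimately have "?g \<in> I \<longleftrightarrow> a \<in> I"
    using assms unfolding normal_pideal_def by blast
  then show "a \<in> I \<inter> carrier P \<longleftrightarrow> ?g \<in> I \<inter> carrier P" using a g by blast
qed

end

theorem theorem4p14: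
  fixes P :: "('a, 'b) partial_algebra_scheme"
    and \<gamma> \<eta> :: "'a \<Rightarrow> 'a"
    and U :: "'a partial_algebra_unit"
    and I :: "'a set"
  assumes "gpea P"
    and "unitizing_automorphism P \<gamma>"
    and "inj_on \<eta> (carrier P)"
    and "\<eta> ` carrier P \<inter> carrier P = {}"
    and "U = unitization P \<gamma> \<eta>"
    and "normal_pideal U I"
    and "riesz_pideal U I"
  shows "normal_pideal P (I \<inter> carrier P) \<and>
         riesz_pideal P (I \<inter> carrier P) \<and>
         gamma_closed P \<gamma> (I \<inter> carrier P)"
proof -
  interpret gpea_unitization P \<gamma> \<eta> U
    using assms by (simp add: gpea_unitization_def gpea_unitization_axioms_def)
  show ?thesis
    using assms normal_pideal_restrict riesz_pideal_restrict gamma_closed_restrict by blast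
qed

end
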